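(* Consider a first-price auction with multiplicative bid augmentation rates $a_i$ and a first-price auction with multiplicative price reduction rates $r_i$, with the same $n$ bidders, and assume that each bidder $i$ has the same distribution of valuations for both auctions. Setting $r_i=\frac{a_i}{1+a_i}$ for each bidder $i$ creates corresponding equilibria (if any) for the first-price auction with bid augmentations as for the one with price reductions. The corresponding equilibria have the same expected utilities for all participants.
   Context: There are $n$ bidders; $\mathbf{v}=(v_1,\dots,v_n)$ is the vector of their valuations and $\mathbf{b}=(b_1,\dots,b_n)$ the vector of their bids. For a vector $\mathbf{x}=(x_1,\dots,x_n)$, $p_i(\mathbf{x})$ denotes the probability that bidder $i$ wins when the winner is selected according to $\mathbf{x}$: it is $1$ if $x_i>x_j$ for all $j\ne i$, $0$ if $x_j>x_i$ for some $j$, and $1/k$ if $k$ bidders, including bidder $i$, tie for the maximum entry of $\mathbf{x}$. First-price auction with multiplicative bid augmentations: bidder $i$ has an augmentation rate $a_i$, the fraction of the bid that is added to it when selecting the winner ($a_i=0$ if bidder $i$ has no discount). The winner is selected using the augmented bids $\hat{\mathbf{b}}=(\hat b_1,\dots,\hat b_n)$ with $\hat b_i=b_i(1+a_i)$, but a winning bidder $i$ pays only the original bid $b_i$. Bidder $i$ has utility $u_i(\mathbf{v},\mathbf{b},\mathbf{a})=p_i(\hat{\mathbf{b}})\,(v_i-b_i)$, where $\mathbf{a}=(a_1,\dots,a_n)$. First-price auction with multiplicative price reductions: bidder $i$ has a reduction rate $r_i$ ($r_i=0$ if there is no discount). The winner is selected using the original bids $\mathbf{b}$, and a winning bidder $i$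 pays $b_i(1-r_i)$. Bidder $i$ has utility $z_i(\mathbf{v},\mathbf{b},\mathbf{r})=p_i(\mathbf{b})\,(v_i-b_i(1-r_i))$, where $\mathbf{r}=(r_1,\dots,r_n)$. In both auctions the seller receives the price paid by the winner. A bid function for a bidder maps that bidder's valuation to a bid, and expected utilities are expectations over the distributions of valuations when bidders bid according to their bid functions. A vector of bid functions $[b_1(\cdot),\dots,b_n(\cdot)]$ is an equilibrium if no bidder can improve their own expected utility by using a different bid function while the other bidders' bid functions stay the same. An equilibrium $[b_1^*(\cdot),\dots,b_n^*(\cdot)]$ of the bid-augmentation auction and an equilibrium of the price-reduction auction correspond when the latter is $[(1+a_1)b_1^*(\cdot),\dots,(1+a_n)b_n^*(\cdot)]$. *)

theory Defs
  imports "HOL-Probability.Probability"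
begin

text \<open>
  The bidders are the elements of a finite type \<open>'n\<close>; vectors of valuations, bids
  and rates are elements of \<open>real ^ 'n\<close>.
\<close>

definition win_prob :: "real ^ 'n \<Rightarrow> 'n \<Rightarrow> real" where
  "win_prob x i =
     (if \<forall>j. j \<noteq> i \<longrightarrow> x $ i > x $ j then 1
      else if \<exists>j. x $ j > x $ i then 0
      else 1 / real (card {j. x $ j = x $ i}))"

definition augmented_bids :: "real ^ 'n \<Rightarrow> real ^ 'n \<Rightarrow> real ^ 'n" where
  "augmented_bids a b = (\<chi> i. b $ i * (1 + a $ i))"

definition aug_utility :: "real ^ 'n \<Rightarrow> real ^ 'n \<Rightarrow> real ^ 'n \<Rightarrow> 'n \<Rightarrow> real" where
  "aug_utility a v b i = win_prob (augmented_bids a b) i * (v $ i - b $ i)"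

definition red_utility :: "real ^ 'n \<Rightarrow> real ^ 'n \<Rightarrow> real ^ 'n \<Rightarrow> 'n \<Rightarrow> real" where
  "red_utility r v b i = win_prob b i * (v $ i - b $ i * (1 - r $ i))"

text \<open>The seller receives the winner's payment, averaged here over the tie-breaking.\<close>

definition aug_revenue :: "real ^ 'n \<Rightarrow> real ^ 'n \<Rightarrow> real" where
  "aug_revenue a b = (\<Sum>i\<in>UNIV. win_prob (augmented_bids a b) i * b $ i)"

definition red_revenue :: "real ^ 'n \<Rightarrow> real ^ 'n \<Rightarrow> real" where
  "red_revenue r b = (\<Sum>i\<in>UNIV. win_prob b i * (b $ i * (1 - r $ i)))"

text \<open>
  \<open>B\<close> is the set of admissible bids, e.g. \<open>{0..}\<close> or \<open>UNIV\<close>. Measurability is what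
  makes expectations over the valuations meaningful.
\<close>

definition bid_function :: "real set \<Rightarrow> (real \<Rightarrow> real) \<Rightarrow> bool" where
  "bid_function B f \<longleftrightarrow> f \<in> borel_measurable borel \<and> range f \<subseteq> B"

definition bids :: "('n \<Rightarrow> real \<Rightarrow> real) \<Rightarrow> real ^ 'n \<Rightarrow> real ^ 'n" where
  "bids \<beta> v = (\<chi> i. \<beta> i (v $ i))"

text \<open>
  \<open>M\<close> is the joint distribution of the valuations (independent valuations are the case
  of a product measure), and \<open>w v b i\<close> is the utility of bidder \<open>i\<close>.

  The integral of a non-integrable function is \<open>0\<close> by convention, so finiteness of the
  expected utilities is required explicitly. Considering only deviations with finite
  expected utility loses nothing: a deviation of bidder \<open>i\<close> with expected utility
  \<open>\<infinity>\<close>, followed only where both the valuation of \<open>i\<close> and the deviating bid are at most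
  \<open>k\<close> in absolute value, has a finite expected utility that tends to \<open>\<infinity>\<close> with \<open>k\<close>.
\<close>

definition equilibrium ::
  "(real ^ 'n) measure \<Rightarrow> real set \<Rightarrow> (real ^ 'n \<Rightarrow> real ^ 'n \<Rightarrow> 'n \<Rightarrow> real) \<Rightarrow>
     ('n \<Rightarrow> real \<Rightarrow> real) \<Rightarrow> bool" where
  "equilibrium M B w \<beta> \<longleftrightarrow>
     (\<forall>i. bid_function B (\<beta> i) \<and> integrable M (\<lambda>v. w v (bids \<beta> v) i)) \<and>
     (\<forall>i g. bid_function B g \<longrightarrow> integrable M (\<lambda>v. w v (bids (\<beta>(i := g)) v) i) \<longrightarrow>
        (\<integral>v. w v (bids (\<beta>(i := g)) v) i \<partial>M) \<le> (\<integral>v. w v (bids \<beta> v) i \<partial>M))"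

definition corresponding :: "real ^ 'n \<Rightarrow> ('n \<Rightarrow> real \<Rightarrow> real) \<Rightarrow> 'n \<Rightarrow> real \<Rightarrow> real" where
  "corresponding a \<beta> = (\<lambda>i x. (1 + a $ i) * \<beta> i x)"

end

theory Submission imports Defs begin

text \<open>
  Since \<open>1 - a / (1 + a) = 1 / (1 + a)\<close>, bidding \<open>(1 + a) * b\<close> under the price reduction is
  ranked like the augmented bid \<open>b\<close> and costs \<open>b\<close>, so the two auctions agree valuation by
  valuation. Scaling by \<open>1 + a > 0\<close> is a bijection of bid functions that also matches the
  deviations of each bidder.
\<close>

lemma one_minus_reduction_rate:
  fixes a :: real
  assumes "a > -1"
  shows "1 - a / (1 + a) = inverse (1 + a)"
  using assms by (simp add: field_simps)

lemma bids_corresponding: "bids (corresponding a \<beta>) v = augmented_bids a (bids \<beta> v)"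
  by (simp add: bids_def corresponding_def augmented_bids_def vec_eq_iff mult.commute)

lemma red_price_augmented_bids:
  assumes "a $ i > -1" "r $ i = a $ i / (1 + a $ i)"
  shows "augmented_bids a b $ i * (1 - r $ i) = b $ i"
  using assms one_minus_reduction_rate[OF assms(1)] by (simp add: augmented_bids_def)

text \<open>Both sides evaluate \<open>win_prob\<close> at the same vector
  \<open>augmented_bids a b\<close>, so ties agree too and only the prices have to be
  compared.\<close>

lemma red_utility_augmented_bids:
  assumes "a $ i > -1" "r $ i = a $ i / (1 + a $ i)"
  shows "red_utility r v (augmented_bids a b) i = aug_utility a v b i"
  by (simp add: red_utility_def aug_utility_def red_price_augmented_bids[OF assms])

lemma red_revenue_augmented_bids:
  assumes "\<And>i. a $ i > -1" "\<And>i. r $ i = a $ i / (1 + a $ i)"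
  shows "red_revenue r (augmented_bids a b) = aug_revenue a b"
  by (simp add: red_revenue_def aug_revenue_def red_price_augmented_bids[OF assms])

lemma corresponding_upd:
  "corresponding a (\<beta>(i := g)) = (corresponding a \<beta>)(i := \<lambda>x. (1 + a $ i) * g x)"
  by (auto simp: corresponding_def fun_eq_iff)

lemma bid_function_scale:
  assumes "\<And>c x. c > 0 \<Longrightarrow> x \<in> B \<Longrightarrow> c * x \<in> B" "c > 0" "bid_function B f"
  shows "bid_function B (\<lambda>x. c * f x)"
  using assms by (auto simp: bid_function_def)

text \<open>\<open>B\<close> is closed under every positive factor, hence under
  \<open>inverse c\<close> as well as \<open>c\<close>, and admissibility passes both ways.\<close>

lemma bid_function_scale_iff:
  assumes "\<And>c x. c > 0 \<Longrightarrow> x \<in> B \<Longrightarrow> c * x \<in> B" "c > 0"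
  shows "bid_function B (\<lambda>x. c * f x) \<longleftrightarrow> bid_function B f"
proof
  assume "bid_function B (\<lambda>x. c * f x)"
  from bid_function_scale[OF assms(1) _ this, of "inverse c"] show "bid_function B f"
    using assms(2) by (simp add: mult.assoc[symmetric])
qed (rule bid_function_scale[OF assms])

text \<open>Multiplying by a nonzero \<open>c i\<close> permutes the functions \<open>g\<close>.
  This reparametrises the deviations of bidder \<open>i\<close> in the definition of
  equilibrium.\<close>

lemma all_scaled_iff:
  fixes c :: "'i \<Rightarrow> 'a :: field"
  assumes "\<And>i. c i \<noteq> 0"
  shows "(\<forall>i (g :: 'b \<Rightarrow> 'a). P i g) \<longleftrightarrow> (\<forall>i g. P i (\<lambda>x. c i * g x))"
proof (intro iffI allI)
  fix i and g :: "'b \<Rightarrow> 'a"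
  assume "\<forall>i g. P i (\<lambda>x. c i * g x)"
  \<comment> \<open>The preimage of \<open>g\<close> under the scaling.\<close>
  then have "P i (\<lambda>x. c i * (g x / c i))" by (elim allE)
  then show "P i g" using assms by simp
qed simp

lemma equilibrium_corresponding_iff:
  fixes a r :: "real ^ 'n"
  assumes cone: "\<And>c x. c > 0 \<Longrightarrow> x \<in> B \<Longrightarrow> c * x \<in> B"
    and a: "\<And>i. a $ i > -1"
    and r: "\<And>i. r $ i = a $ i / (1 + a $ i)"
  shows "equilibrium M B (red_utility r) (corresponding a \<beta>) \<longleftrightarrow>
         equilibrium M B (aug_utility a) \<beta>"
proof -
  \<comment> \<open>Positivity keeps scaled bids inside \<open>B\<close>; being nonzero makes the
    scaling of deviations invertible.\<close>
  have pos: "1 + a $ i > 0" for i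
    using a[of i] by simp
  have u: "red_utility r v (bids (corresponding a \<gamma>) v) i = aug_utility a v (bids \<gamma> v) i"
    for \<gamma> v i
    by (simp add: bids_corresponding red_utility_augmented_bids[OF a r])
  have bf: "bid_function B (\<lambda>x. (1 + a $ i) * f x) \<longleftrightarrow> bid_function B f" for f i
    by (rule bid_function_scale_iff[OF cone pos])
  have bfc: "bid_function B (corresponding a \<beta> i) \<longleftrightarrow> bid_function B (\<beta> i)" for i
    using bf[of i "\<beta> i"] by (simp add: corresponding_def)
  show ?thesis
    unfolding equilibrium_def
    \<comment> \<open>Each deviation in the reduction auction is written as
      \<open>(1 + a $ i) * g x\<close>. By \<open>corresponding_upd\<close> the deviating profile is
      then \<open>corresponding a (\<beta>(i := g))\<close>, and \<open>u\<close> turns its utility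
      into that of the deviation \<open>g\<close> in the augmentation auction.\<close>
    by (subst all_scaled_iff[where c = "\<lambda>i. 1 + a $ i", OF pos[THEN less_imp_neq, symmetric]]) (simp add: corresponding_upd[symmetric] u bf bfc)
qed

text \<open>The factor for \<open>- r\<close> is \<open>1 - r $ i = inverse (1 + a $ i)\<close>, so
  \<open>corresponding (- r)\<close> undoes \<open>corresponding a\<close>.\<close>

lemma corresponding_inverse:
  assumes "\<And>i. a $ i > -1" "\<And>i. r $ i = a $ i / (1 + a $ i)"
  shows "corresponding (- r) (corresponding a \<beta>) = \<beta>"
    and "corresponding a (corresponding (- r) \<beta>) = \<beta>"
proof -
  have "1 - r $ i = inverse (1 + a $ i)" "1 + a $ i \<noteq> 0" for i
    using one_minus_reduction_rate[OF assms(1)[of i]] assms(1)[of i] by (simp_all add: assms(2))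
  then show "corresponding (- r) (corresponding a \<beta>) = \<beta>"
    and "corresponding a (corresponding (- r) \<beta>) = \<beta>"
    by (simp_all add: corresponding_def fun_eq_iff mult.assoc[symmetric])
qed

theorem theorem3p1:
  fixes M :: "(real ^ 'n) measure"
    and B :: "real set"
    and a r :: "real ^ 'n"
  assumes "prob_space M"
    and "sets M = sets borel"
    and "\<And>c x. c > 0 \<Longrightarrow> x \<in> B \<Longrightarrow> c * x \<in> B"
    and "\<And>i. a $ i > -1"
    and "\<And>i. r $ i = a $ i / (1 + a $ i)"
  shows "bij_betw (corresponding a)
           {\<beta>. equilibrium M B (aug_utility a) \<beta>}
           {\<gamma>. equilibrium M B (red_utility r) \<gamma>} \<and>
         (\<forall>\<beta>. equilibrium M B (aug_utility a) \<beta> \<longrightarrow>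
           (\<forall>i. (\<integral>v. aug_utility a v (bids \<beta> v) i \<partial>M) =
                 (\<integral>v. red_utility r v (bids (corresponding a \<beta>) v) i \<partial>M)) \<and>
           (integrable M (\<lambda>v. aug_revenue a (bids \<beta> v)) \<longleftrightarrow>
              integrable M (\<lambda>v. red_revenue r (bids (corresponding a \<beta>) v))) \<and>
           (\<integral>v. aug_revenue a (bids \<beta> v) \<partial>M) =
             (\<integral>v. red_revenue r (bids (corresponding a \<beta>) v) \<partial>M))"
proof (intro conjI allI impI)
  note ar = assms(4,5)
  show "bij_betw (corresponding a)
          {\<beta>. equilibrium M B (aug_utility a) \<beta>} {\<gamma>. equilibrium M B (red_utility r) \<gamma>}"
  proof (rule bij_betw_byWitness[where f' = "corresponding (- r)"])
    show "corresponding (- r) ` {\<gamma>. equilibrium M B (red_utility r) \<gamma>}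
          \<subseteq> {\<beta>. equilibrium M B (aug_utility a) \<beta>}"
      \<comment> \<open>A reduction equilibrium \<gamma> equals
        \<open>corresponding a (corresponding (- r) \<gamma>)\<close>, so the equivalence pulls it
        back.\<close>
      using equilibrium_corresponding_iff[OF assms(3) ar, of M "corresponding (- r) _"]
      by (auto simp: corresponding_inverse[OF ar])
  qed (auto simp: corresponding_inverse[OF ar] equilibrium_corresponding_iff[OF assms(3) ar])
\<comment> \<open>The integrands coincide at every \<open>v\<close>, which settles the integrals and
  the integrability of the revenue at once.\<close>
qed (simp_all add: bids_corresponding red_utility_augmented_bids[OF assms(4,5)]
      red_revenue_augmented_bids[OF assms(4,5)])

end
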